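(* Let $M=(E,\mathcal I)$ be a matroid with weights $\sigma\in\mathbb R^E_{>0}$. Let $\eta^*$ be the universal density of $M$ with weights $\sigma$, and let $E_{\max}$ be the set of elements $e\in E$ at which $\sigma(e)^{-1}\eta^*(e)$ attains its maximal value. Let $H$ be a subset of $E$. If $H\subseteq E-E_{\max}$, then $S_\sigma(M/H)=S_\sigma(M)$.
   Context: The matroid $M$ is finite, loopless and of positive rank. The universal density of $M$ with weights $\sigma$ is the unique minimizer of $\sum_{e\in E}\sigma(e)^{-1}\eta(e)^2$ over the convex hull in $\mathbb R^E$ of the indicator vectors of the bases of $M$. For a matroid of positive rank with ground set $E$, rank function $r$ and weights $\sigma$, $$S_\sigma(M)=\min\Big\{\tfrac{\sigma(X)}{r(E)-r(E-X)}:X\subseteq E,\ r(E)>r(E-X)\Big\},\qquad \sigma(X)=\sum_{e\in X}\sigma(e).$$ $M/H$ is the contraction of $H$, a matroid on $E-H$ with rank function $r_{M/H}(Y)=r(H\cup Y)-r(H)$ and the restricted weights. *)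

theory Defs
  imports "HOL-Analysis.Analysis" "HOL-Library.Function_Algebras"
begin

record 'a matroid_data =
  ground :: "'a set"
  indep :: "'a set set"

locale matroid =
  fixes M :: "'a matroid_data"
  assumes finite_ground: "finite (ground M)"
    and indep_ground: "X \<in> indep M \<Longrightarrow> X \<subseteq> ground M"
    and indep_empty: "{} \<in> indep M"
    and indep_subset: "\<lbrakk>X \<in> indep M; Y \<subseteq> X\<rbrakk> \<Longrightarrow> Y \<in> indep M"
    and indep_augment: "\<lbrakk>X \<in> indep M; Y \<in> indep M; card X < card Y\<rbrakk>
                          \<Longrightarrow> \<exists>y \<in> Y - X. insert y X \<in> indep M"

definition rank_of :: "'a matroid_data \<Rightarrow> 'a set \<Rightarrow> nat" where
  "rank_of M X = Max (card ` {Y \<in> indep M. Y \<subseteq> X})"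

definition loopless :: "'a matroid_data \<Rightarrow> bool" where
  "loopless M \<longleftrightarrow> (\<forall>e \<in> ground M. {e} \<in> indep M)"

definition bases :: "'a matroid_data \<Rightarrow> 'a set set" where
  "bases M = {B \<in> indep M. \<forall>Y \<in> indep M. B \<subseteq> Y \<longrightarrow> Y = B}"

text \<open>
  A matroid is determined by its rank function, a set being independent iff its rank is its
  cardinality.  The contraction of \<open>H\<close> is the matroid on the complement of \<open>H\<close> whose rank
  function is \<open>\<lambda>Y. r (H \<union> Y) - r H\<close>; see \<open>matroid_contract\<close> and \<open>rank_contract\<close> below.
\<close>

definition contract :: "'a matroid_data \<Rightarrow> 'a set \<Rightarrow> 'a matroid_data" where
  "contract M H =
     \<lparr>ground = ground M - H,
      indep = {Y. Y \<subseteq> ground M - H \<and> rank_of M (H \<union> Y) - rank_of M H = card Y}\<rparr>"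

text \<open>
  Only meaningful for positive rank, as otherwise the minimum is over the empty set.  Weights are
  functions on the whole type of which only the values on the ground set matter, so the weights
  restricted to a contraction are given by the same function.
\<close>

definition strength :: "('a \<Rightarrow> real) \<Rightarrow> 'a matroid_data \<Rightarrow> real" where
  "strength \<sigma> M =
     Min {sum \<sigma> X / (real (rank_of M (ground M)) - real (rank_of M (ground M - X))) | X.
          X \<subseteq> ground M \<and> rank_of M (ground M) > rank_of M (ground M - X)}"

text \<open>
  Vectors indexed by the ground set \<open>E\<close> are functions on the whole type that vanish outside \<open>E\<close>.
  The pointwise vector space structure makes the library's \<open>convex hull\<close> available for them.
\<close>

instantiation "fun" :: (type, real_vector) real_vector
begin

definition scaleR_fun :: "real \<Rightarrow> ('a \<Rightarrow> 'b) \<Rightarrow> 'a \<Rightarrow> 'b" where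
  "scaleR_fun c f = (\<lambda>x. c *\<^sub>R f x)"

instance
  by standard (auto simp: scaleR_fun_def fun_eq_iff algebra_simps)

end

definition base_polytope :: "'a matroid_data \<Rightarrow> ('a \<Rightarrow> real) set" where
  "base_polytope M = convex hull (indicator ` bases M)"

definition energy :: "('a \<Rightarrow> real) \<Rightarrow> 'a matroid_data \<Rightarrow> ('a \<Rightarrow> real) \<Rightarrow> real" where
  "energy \<sigma> M \<eta> = (\<Sum>e \<in> ground M. inverse (\<sigma> e) * (\<eta> e)\<^sup>2)"

definition universal_density :: "('a \<Rightarrow> real) \<Rightarrow> 'a matroid_data \<Rightarrow> 'a \<Rightarrow> real" where
  "universal_density \<sigma> M =
     (THE \<eta>. \<eta> \<in> base_polytope M \<and> (\<forall>\<theta> \<in> base_polytope M. energy \<sigma> M \<eta> \<le> energy \<sigma> M \<theta>))"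

context matroid
begin

lemma finite_indep: "finite {Y \<in> indep M. Y \<subseteq> X}"
  by (rule finite_subset[of _ "Pow (ground M)"]) (use indep_ground finite_ground in auto)

lemma indep_finite: "Y \<in> indep M \<Longrightarrow> finite Y"
  using indep_ground finite_ground finite_subset by blast

lemma rank_attained: "\<exists>Y. Y \<in> indep M \<and> Y \<subseteq> X \<and> card Y = rank_of M X"
proof -
  have "{Y \<in> indep M. Y \<subseteq> X} \<noteq> {}" using indep_empty by auto
  then have "rank_of M X \<in> card ` {Y \<in> indep M. Y \<subseteq> X}"
    unfolding rank_of_def using finite_indep by (intro Max_in) auto
  then show ?thesis by force
qed

lemma card_le_rank: "\<lbrakk>Y \<in> indep M; Y \<subseteq> X\<rbrakk> \<Longrightarrow> card Y \<le> rank_of M X"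
  unfolding rank_of_def using finite_indep by (intro Max_ge) auto

lemma rank_mono: "X \<subseteq> Y \<Longrightarrow> rank_of M X \<le> rank_of M Y"
  by (metis rank_attained card_le_rank subset_trans)

lemma extend_to_rank:
  assumes "Y \<in> indep M" "Y \<subseteq> X"
  shows "\<exists>Z. Z \<in> indep M \<and> Y \<subseteq> Z \<and> Z \<subseteq> X \<and> card Z = rank_of M X"
  using assms
proof (induction "rank_of M X - card Y" arbitrary: Y)
  case 0
  then show ?case using card_le_rank[of Y X] by (intro exI[of _ Y]) auto
next
  case (Suc n)
  obtain W where W: "W \<in> indep M" "W \<subseteq> X" "card W = rank_of M X" using rank_attained by blast
  with Suc obtain y where y: "y \<in> W - Y" "insert y Y \<in> indep M"
    using indep_augment[of Y W] by fastforce
  have "card (insert y Y) = Suc (card Y)" using y indep_finite[of Y] Suc.prems by auto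
  then have "n = rank_of M X - card (insert y Y)" using Suc.hyps(2) by auto
  from Suc.hyps(1)[OF this y(2)] y W Suc.prems show ?case by auto
qed

lemma indep_contract_iff:
  assumes "H \<subseteq> ground M" "B \<in> indep M" "B \<subseteq> H" "card B = rank_of M H"
  shows "Y \<in> indep (contract M H) \<longleftrightarrow> Y \<subseteq> ground M - H \<and> B \<union> Y \<in> indep M"
proof (cases "Y \<subseteq> ground M - H")
  case Y: True
  have fin: "finite B" "finite Y" using assms indep_finite Y finite_ground finite_subset by blast+
  have card: "card (B \<union> Y) = rank_of M H + card Y"
    using card_Un_disjoint[OF fin] assms Y by auto
  have "rank_of M (H \<union> Y) - rank_of M H = card Y \<longleftrightarrow> B \<union> Y \<in> indep M"
  proof
    assume eq: "rank_of M (H \<union> Y) - rank_of M H = card Y"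
    obtain Z where Z: "Z \<in> indep M" "B \<subseteq> Z" "Z \<subseteq> H \<union> Y" "card Z = rank_of M (H \<union> Y)"
      using extend_to_rank[of B "H \<union> Y"] assms by auto
    have finZ: "finite Z" using Z indep_finite by auto
    have "Z \<inter> H \<in> indep M" using Z indep_subset[of Z] by auto
    then have "card (Z \<inter> H) \<le> card B" using card_le_rank[of "Z \<inter> H" H] assms by auto
    moreover have "B \<subseteq> Z \<inter> H" using Z assms by auto
    ultimately have "Z \<inter> H = B" using finZ by (metis card_seteq finite_Int)
    then have sub: "Z \<subseteq> B \<union> Y" using Z by auto
    have "card Z = card (B \<union> Y)" using eq Z card rank_mono[of H "H \<union> Y"] by auto
    then have "Z = B \<union> Y" using sub fin by (metis card_subset_eq finite_Un)
    then show "B \<union> Y \<in> indep M" using Z by auto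
  next
    assume ind: "B \<union> Y \<in> indep M"
    have "rank_of M H + card Y \<le> rank_of M (H \<union> Y)"
      using card_le_rank[OF ind, of "H \<union> Y"] card assms by auto
    moreover have "rank_of M (H \<union> Y) \<le> rank_of M H + card Y"
    proof -
      obtain Z where Z: "Z \<in> indep M" "Z \<subseteq> H \<union> Y" "card Z = rank_of M (H \<union> Y)"
        using rank_attained by blast
      have "Z \<inter> H \<in> indep M" using Z indep_subset[of Z] by auto
      then have "card (Z \<inter> H) \<le> rank_of M H" using card_le_rank by auto
      moreover have "card (Z - H) \<le> card Y" using Z fin by (intro card_mono) auto
      moreover have "card Z = card (Z \<inter> H) + card (Z - H)"
        using Z indep_finite by (metis card_Int_Diff)
      ultimately show ?thesis using Z by auto
    qed
    ultimately show "rank_of M (H \<union> Y) - rank_of M H = card Y" by auto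
  qed
  then show ?thesis using Y by (simp add: contract_def)
qed (simp add: contract_def)

lemma matroid_contract:
  assumes H: "H \<subseteq> ground M"
  shows "matroid (contract M H)"
proof -
  obtain B where B: "B \<in> indep M" "B \<subseteq> H" "card B = rank_of M H" using rank_attained by blast
  note iff = indep_contract_iff[OF H B]
  show ?thesis
  proof
    show "finite (ground (contract M H))" using finite_ground by (simp add: contract_def)
    show "X \<subseteq> ground (contract M H)" if "X \<in> indep (contract M H)" for X
      using that by (simp add: contract_def)
    show "{} \<in> indep (contract M H)" using iff[of "{}"] B by simp
    show "Y \<in> indep (contract M H)" if "X \<in> indep (contract M H)" "Y \<subseteq> X" for X Y
      using that iff[of X] iff[of Y] indep_subset[of "B \<union> X" "B \<union> Y"] by auto
    show "\<exists>y \<in> Y - X. insert y X \<in> indep (contract M H)"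
      if "X \<in> indep (contract M H)" "Y \<in> indep (contract M H)" "card X < card Y" for X Y
    proof -
      have X: "X \<subseteq> ground M - H" "B \<union> X \<in> indep M" and Y: "Y \<subseteq> ground M - H" "B \<union> Y \<in> indep M"
        using that iff by auto
      have fin: "finite B" "finite X" "finite Y" using X Y indep_finite by auto
      have "card (B \<union> X) = card B + card X" "card (B \<union> Y) = card B + card Y"
        using fin X Y B by (subst card_Un_disjoint; auto)+
      then have "card (B \<union> X) < card (B \<union> Y)" using that(3) by simp
      then obtain y where y: "y \<in> (B \<union> Y) - (B \<union> X)" "insert y (B \<union> X) \<in> indep M"
        using indep_augment[OF X(2) Y(2)] by blast
      then have "insert y X \<in> indep (contract M H)" using iff[of "insert y X"] X Y by auto
      then show ?thesis using y by auto
    qed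
  qed
qed

lemma rank_contract:
  assumes H: "H \<subseteq> ground M" and Y: "Y \<subseteq> ground M - H"
  shows "rank_of (contract M H) Y = rank_of M (H \<union> Y) - rank_of M H"
proof -
  obtain B where B: "B \<in> indep M" "B \<subseteq> H" "card B = rank_of M H" using rank_attained by blast
  note iff = indep_contract_iff[OF H B]
  interpret C: matroid "contract M H" using matroid_contract[OF H] .
  show ?thesis
  proof (rule antisym)
    obtain Z where Z: "Z \<in> indep (contract M H)" "Z \<subseteq> Y" "card Z = rank_of (contract M H) Y"
      using C.rank_attained by blast
    have "card Z = rank_of M (H \<union> Z) - rank_of M H" using Z by (simp add: contract_def)
    then show "rank_of (contract M H) Y \<le> rank_of M (H \<union> Y) - rank_of M H"
      using Z rank_mono[of "H \<union> Z" "H \<union> Y"] by (metis Un_mono diff_le_mono order_refl)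
  next
    obtain Z where Z: "Z \<in> indep M" "B \<subseteq> Z" "Z \<subseteq> H \<union> Y" "card Z = rank_of M (H \<union> Y)"
      using extend_to_rank[of B "H \<union> Y"] B by auto
    have "B \<union> (Z - H) \<in> indep M" using Z indep_subset[of Z "B \<union> (Z - H)"] by auto
    then have "Z - H \<in> indep (contract M H)" using iff[of "Z - H"] Z Y by auto
    then have "card (Z - H) \<le> rank_of (contract M H) Y" using C.card_le_rank[of "Z - H" Y] Z by auto
    moreover have "card (Z \<inter> H) \<le> rank_of M H"
      using Z indep_subset[of Z "Z \<inter> H"] card_le_rank[of "Z \<inter> H" H] by auto
    moreover have "card Z = card (Z \<inter> H) + card (Z - H)"
      using Z indep_finite by (metis card_Int_Diff)
    ultimately show "rank_of M (H \<union> Y) - rank_of M H \<le> rank_of (contract M H) Y" using Z by auto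
  qed
qed

lemma finite_bases: "finite (bases M)"
  by (rule finite_subset[of _ "{Y \<in> indep M. Y \<subseteq> ground M}"])
     (use finite_indep indep_ground in \<open>auto simp: bases_def\<close>)

lemma bases_nonempty: "bases M \<noteq> {}"
proof -
  obtain B where B: "B \<in> indep M" "card B = rank_of M (ground M)" using rank_attained by blast
  have "Y = B" if "Y \<in> indep M" "B \<subseteq> Y" for Y
    using that B card_le_rank[of Y "ground M"] indep_ground[of Y] indep_finite[of Y]
    by (metis card_seteq)
  then show ?thesis using B by (auto simp: bases_def)
qed

lemma compact_hull_fun:
  fixes S :: "('b \<Rightarrow> real) set"
  assumes "finite S"
  shows "compact (convex hull S)"
  using assms
proof (induction S)
  case (insert a S)
  show ?case
  proof (cases "S = {}")
    case False
    define g :: "real \<times> ('b \<Rightarrow> real) \<Rightarrow> 'b \<Rightarrow> real"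
      where "g = (\<lambda>p x. (1 - fst p) * a x + fst p * snd p x)"
    have "convex hull (insert a S) = g ` ({0..1} \<times> (convex hull S))"
      unfolding convex_hull_insert_alt[of a S] if_not_P[OF False]
      by (fastforce simp: g_def image_iff scaleR_fun_def plus_fun_def)
    moreover have "continuous_on ({0..1} \<times> (convex hull S)) g"
    proof (rule continuous_on_coordinatewise_then_product)
      fix x :: 'b
      have "continuous_on ({0..1} \<times> (convex hull S)) (\<lambda>p :: real \<times> ('b \<Rightarrow> real). snd p x)"
        by (rule continuous_on_product_then_coordinatewise[of _ snd]) (intro continuous_intros)
      then show "continuous_on ({0..1} \<times> (convex hull S)) (\<lambda>p. g p x)"
        unfolding g_def by (intro continuous_intros)
    qed
    ultimately show ?thesis
      using insert.IH by (simp add: compact_continuous_image compact_Times)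
  qed simp
qed simp

lemma polytope_outside:
  assumes "\<eta> \<in> base_polytope M" "e \<notin> ground M"
  shows "\<eta> e = 0"
proof -
  have "convex {f :: 'a \<Rightarrow> real. f e = 0}"
    by (auto simp: convex_def scaleR_fun_def plus_fun_def)
  moreover have "indicator ` bases M \<subseteq> {f :: 'a \<Rightarrow> real. f e = 0}"
    using assms(2) indep_ground by (fastforce simp: bases_def indicator_def)
  ultimately show ?thesis using assms(1) hull_minimal unfolding base_polytope_def by blast
qed

lemma universal_density_ex1:
  assumes pos: "\<forall>e \<in> ground M. \<sigma> e > 0"
  shows "\<exists>!\<eta>. \<eta> \<in> base_polytope M \<and> (\<forall>\<theta> \<in> base_polytope M. energy \<sigma> M \<eta> \<le> energy \<sigma> M \<theta>)"
proof -
  have coord: "continuous_on (base_polytope M) (\<lambda>\<eta>. \<eta> e)" for e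
    by (rule continuous_on_subset[OF continuous_on_product_coordinates]) simp
  have "compact (base_polytope M)"
    unfolding base_polytope_def using finite_bases by (intro compact_hull_fun) auto
  moreover have "base_polytope M \<noteq> {}" using bases_nonempty by (simp add: base_polytope_def)
  moreover have "continuous_on (base_polytope M) (energy \<sigma> M)"
    unfolding energy_def
    by (intro continuous_on_sum continuous_on_mult continuous_on_const continuous_on_power coord)
  ultimately obtain \<eta> where \<eta>: "\<eta> \<in> base_polytope M"
    "\<forall>\<theta> \<in> base_polytope M. energy \<sigma> M \<eta> \<le> energy \<sigma> M \<theta>"
    using continuous_attains_inf by blast
  have "\<theta> = \<eta>" if \<theta>: "\<theta> \<in> base_polytope M" "energy \<sigma> M \<theta> \<le> energy \<sigma> M \<eta>" for \<theta>
  proof -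
    define m where "m = (1/2) *\<^sub>R \<eta> + (1/2) *\<^sub>R \<theta>"
    have "convex (base_polytope M)" by (simp add: base_polytope_def)
    then have "m \<in> base_polytope M" using \<eta>(1) \<theta>(1) unfolding m_def by (intro convexD) auto
    then have le: "energy \<sigma> M \<eta> \<le> energy \<sigma> M m" using \<eta>(2) by auto
    have eq: "4 * energy \<sigma> M m + (\<Sum>e \<in> ground M. inverse (\<sigma> e) * (\<eta> e - \<theta> e)\<^sup>2)
                = 2 * energy \<sigma> M \<eta> + 2 * energy \<sigma> M \<theta>"
      unfolding energy_def m_def sum_distrib_left sum.distrib[symmetric] plus_fun_def scaleR_fun_def
      by (intro sum.cong) (simp_all add: power2_eq_square algebra_simps)
    have nn: "0 \<le> inverse (\<sigma> e) * (\<eta> e - \<theta> e)\<^sup>2" if "e \<in> ground M" for e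
      using pos that by (auto simp: less_imp_le)
    have "(\<Sum>e \<in> ground M. inverse (\<sigma> e) * (\<eta> e - \<theta> e)\<^sup>2) = 0"
      by (rule antisym) (use eq le \<theta>(2) nn in \<open>auto intro: sum_nonneg\<close>)
    then have "\<forall>e \<in> ground M. inverse (\<sigma> e) * (\<eta> e - \<theta> e)\<^sup>2 = 0"
      using sum_nonneg_eq_0_iff[OF finite_ground nn] by auto
    then have "\<theta> e = \<eta> e" if "e \<in> ground M" for e using pos that by force
    then show "\<theta> = \<eta>" using polytope_outside \<eta>(1) \<theta>(1) by (metis ext)
  qed
  then show ?thesis using \<eta> by blast
qed

end

end

theory Submission
  imports Defs
begin

text \<open>
  Write \<open>E\<close> for the ground set, \<open>w e = \<eta> e / \<sigma> e\<close>, \<open>t\<close> for the maximal value of \<open>w\<close> and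
  \<open>F = E - E_max\<close>.  Both strengths turn out to be \<open>1 / t\<close>.

  Every vector \<open>\<theta>\<close> of the base polytope has \<open>\<theta>(E) = r(E)\<close> and \<open>\<theta>(Y) \<le> r(Y)\<close>, so
  \<open>t \<sigma>(X) \<ge> \<eta>(X) \<ge> r(E) - r(E - X)\<close> for every \<open>X\<close>: no ratio in the definition of the strength of
  \<open>M\<close> is below \<open>1 / t\<close>.  The set \<open>E_max\<close> attains this bound provided that \<open>\<eta>(F) = r(F)\<close>, because
  \<open>\<eta> = t \<sigma>\<close> on \<open>E_max\<close>.

  The equality \<open>\<eta>(F) = r(F)\<close> is where minimality of the energy enters
  (\<open>sum_minimizer_eq_rank\<close>).  Its first-order form says that \<open>\<eta>\<close> minimizes the linear functional
  with coefficients \<open>w\<close> over the polytope (\<open>energy_minimizer_linear\<close>), so each basis with positive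
  coefficient in a convex decomposition of \<open>\<eta>\<close> has minimal \<open>w\<close>-weight.  A basis \<open>B\<close> with
  \<open>|B \<inter> F| < r(F)\<close> admits an exchange of an element of \<open>E_max\<close> for one of \<open>F\<close>
  (\<open>basis_exchange_into\<close>), which lowers its weight strictly; hence only bases with
  \<open>|B \<inter> F| = r(F)\<close> occur in \<open>\<eta>\<close>.

  Finally, deleting \<open>X\<close> lowers the rank of \<open>M/H\<close> by as much as it lowers that of \<open>M\<close>
  (\<open>rank_drop_contract\<close>).  The ratios of \<open>M/H\<close> are thus those ratios of \<open>M\<close> whose set \<open>X\<close> avoids
  \<open>H\<close>, and \<open>E_max\<close> is such a set if \<open>H \<subseteq> F\<close>.
\<close>

context matroid
begin

section \<open>Bases\<close>

lemma bases_iff: "B \<in> bases M \<longleftrightarrow> B \<in> indep M \<and> card B = rank_of M (ground M)"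
proof
  assume B: "B \<in> bases M"
  then have ind: "B \<in> indep M" by (simp add: bases_def)
  then obtain Z where "Z \<in> indep M" "B \<subseteq> Z" "card Z = rank_of M (ground M)"
    using extend_to_rank[of B "ground M"] indep_ground by blast
  then show "B \<in> indep M \<and> card B = rank_of M (ground M)"
    using B ind by (auto simp: bases_def)
next
  assume B: "B \<in> indep M \<and> card B = rank_of M (ground M)"
  have "Y = B" if "Y \<in> indep M" "B \<subseteq> Y" for Y
    using that B card_le_rank[of Y "ground M"] indep_ground[of Y] indep_finite[of Y]
    by (metis card_seteq)
  then show "B \<in> bases M" using B by (auto simp: bases_def)
qed

text \<open>
  Part of a larger independent subset of \<open>F\<close> can be added to \<open>B \<inter> F\<close>.  Adding one element \<open>f\<close> of
  it and extending within \<open>B \<union> {f}\<close> to a basis loses exactly one element of \<open>B\<close>, which lies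
  outside \<open>F\<close> because all of \<open>B \<inter> F\<close> is kept.
\<close>

lemma basis_exchange_into:
  assumes B: "B \<in> bases M" and less: "card (B \<inter> F) < rank_of M F"
  shows "\<exists>e \<in> B - F. \<exists>f \<in> F - B. insert f (B - {e}) \<in> bases M"
proof -
  have indB: "B \<in> indep M" and cardB: "card B = rank_of M (ground M)"
    using B bases_iff by auto
  have finB: "finite B" using indB indep_finite by blast
  have indBF: "B \<inter> F \<in> indep M" using indB indep_subset by blast
  obtain Z where Z: "Z \<in> indep M" "Z \<subseteq> F" "card Z = rank_of M F"
    using rank_attained by blast
  obtain f where f: "f \<in> Z - B \<inter> F" and indf: "insert f (B \<inter> F) \<in> indep M"
    using indep_augment[OF indBF Z(1)] Z less by auto
  have fF: "f \<in> F - B" using f Z by auto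
  obtain C where C: "C \<in> indep M" "insert f (B \<inter> F) \<subseteq> C" "C \<subseteq> insert f B"
      and cardC: "card C = rank_of M (insert f B)"
    using extend_to_rank[OF indf, of "insert f B"] by blast
  have "card B \<le> card C" using cardC card_le_rank[OF indB, of "insert f B"] by auto
  moreover have "card C \<le> card B"
    using cardB card_le_rank[OF C(1)] indep_ground[OF C(1)] by simp
  ultimately have eq: "card C = card B" by simp
  have "\<not> insert f B \<subseteq> C"
    using eq fF finB card_mono[of C "insert f B"] indep_finite[OF C(1)] by auto
  then obtain e where e: "e \<in> insert f B" "e \<notin> C" by blast
  have eB: "e \<in> B - F" using e C by auto
  have "C \<subseteq> insert f (B - {e})" using C e by auto
  moreover have "card (insert f (B - {e})) = card C"
    using eq eB fF finB card_Suc_Diff1[of B e] by simp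
  ultimately have "C = insert f (B - {e})" using finB by (simp add: card_subset_eq)
  then have "insert f (B - {e}) \<in> bases M" using C eq cardB bases_iff by simp
  then show ?thesis using eB fF by blast
qed

section \<open>The base polytope\<close>

text \<open>
  Convex combinations are only ever evaluated under linear functionals of the coordinates in some
  set \<open>X\<close>: such a functional averages its values on the bases.
\<close>

lemma base_polytope_decomposition:
  assumes "\<theta> \<in> base_polytope M"
  shows "\<exists>u. (\<forall>B\<in>bases M. 0 \<le> u B) \<and> sum u (bases M) = 1 \<and>
    (\<forall>w X. finite X \<longrightarrow> (\<Sum>e\<in>X. w e * \<theta> e) = (\<Sum>B\<in>bases M. u B * sum w (B \<inter> X)))"
proof -
  let ?S = "indicator ` bases M :: ('a \<Rightarrow> real) set"
  have inj: "inj_on (indicator :: 'a set \<Rightarrow> 'a \<Rightarrow> real) (bases M)"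
    by (auto simp: inj_on_def fun_eq_iff indicator_def split: if_splits)
  obtain v where v: "\<forall>x\<in>?S. 0 \<le> v x" "sum v ?S = 1" "(\<Sum>x\<in>?S. v x *\<^sub>R x) = \<theta>"
    using assms finite_bases unfolding base_polytope_def
    by (auto simp: convex_hull_finite)
  define u :: "'a set \<Rightarrow> real" where "u = (\<lambda>B. v (indicator B))"
  have apply_sum: "(\<Sum>x\<in>A. g x) e = (\<Sum>x\<in>A. g x e)"
    if "finite A" for A and g :: "'a set \<Rightarrow> 'a \<Rightarrow> real" and e
    using that by (induction A) (simp_all add: zero_fun_def plus_fun_def)
  have "\<theta> = (\<Sum>B\<in>bases M. u B *\<^sub>R indicator B)"
    using v(3) by (simp add: sum.reindex[OF inj] u_def)
  then have \<theta>: "\<theta> e = (\<Sum>B\<in>bases M. u B * indicator B e)" for e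
    by (simp add: apply_sum finite_bases scaleR_fun_def)
  show ?thesis
  proof (intro exI[of _ u] conjI ballI allI impI)
    show "0 \<le> u B" if "B \<in> bases M" for B using v(1) that by (simp add: u_def)
    show "sum u (bases M) = 1" using v(2) by (simp add: sum.reindex[OF inj] u_def)
    fix w :: "'a \<Rightarrow> real" and X :: "'a set"
    assume X: "finite X"
    have "(\<Sum>e\<in>X. w e * \<theta> e) = (\<Sum>B\<in>bases M. \<Sum>e\<in>X. u B * (w e * indicator B e))"
      unfolding \<theta> sum_distrib_left by (subst sum.swap) (simp add: mult_ac)
    also have "\<dots> = (\<Sum>B\<in>bases M. u B * (\<Sum>e\<in>X. w e * indicator B e))"
      by (simp add: sum_distrib_left)
    also have "\<dots> = (\<Sum>B\<in>bases M. u B * sum w (B \<inter> X))"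
      using X by (intro sum.cong refl) (simp add: sum.inter_restrict Int_commute indicator_def if_distrib cong: if_cong)
    finally show "(\<Sum>e\<in>X. w e * \<theta> e) = (\<Sum>B\<in>bases M. u B * sum w (B \<inter> X))" .
  qed
qed

lemma base_polytope_sum_ground:
  assumes "\<theta> \<in> base_polytope M"
  shows "sum \<theta> (ground M) = real (rank_of M (ground M))"
proof -
  obtain u where u: "\<And>B. B \<in> bases M \<Longrightarrow> 0 \<le> u B" "sum u (bases M) = 1"
    "\<And>w X. finite X \<Longrightarrow> (\<Sum>e\<in>X. w e * \<theta> e) = (\<Sum>B\<in>bases M. u B * sum w (B \<inter> X))"
    using base_polytope_decomposition[OF assms] by metis
  have "sum \<theta> (ground M) = (\<Sum>B\<in>bases M. u B * real (card (B \<inter> ground M)))"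
    using u(3)[OF finite_ground, of "\<lambda>_. 1"] by simp
  also have "\<dots> = (\<Sum>B\<in>bases M. u B * real (rank_of M (ground M)))"
    using bases_iff indep_ground by (intro sum.cong refl) (simp add: Int_absorb2)
  finally show ?thesis using u(2) by (simp flip: sum_distrib_right)
qed

lemma card_basis_Int_le_rank:
  assumes "B \<in> bases M"
  shows "card (B \<inter> X) \<le> rank_of M X"
  using assms bases_iff indep_subset[of B "B \<inter> X"] by (intro card_le_rank) auto

lemma base_polytope_sum_le_rank:
  assumes "\<theta> \<in> base_polytope M" "X \<subseteq> ground M"
  shows "sum \<theta> X \<le> real (rank_of M X)"
proof -
  obtain u where u: "\<And>B. B \<in> bases M \<Longrightarrow> 0 \<le> u B" "sum u (bases M) = 1"
    "\<And>w X. finite X \<Longrightarrow> (\<Sum>e\<in>X. w e * \<theta> e) = (\<Sum>B\<in>bases M. u B * sum w (B \<inter> X))"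
    using base_polytope_decomposition[OF assms(1)] by metis
  have "finite X" using assms(2) finite_ground finite_subset by blast
  from u(3)[OF this, of "\<lambda>_. 1"]
  have "sum \<theta> X = (\<Sum>B\<in>bases M. u B * real (card (B \<inter> X)))" by simp
  also have "\<dots> \<le> (\<Sum>B\<in>bases M. u B * real (rank_of M X))"
    using u(1) card_basis_Int_le_rank by (intro sum_mono mult_left_mono) auto
  finally show ?thesis using u(2) by (simp flip: sum_distrib_right)
qed

text \<open>By complementation, each vector of the polytope puts weight on \<open>X\<close> whenever every basis meets
  \<open>X\<close>; this bounds the denominators of the strength.\<close>

lemma rank_drop_le_base_polytope_sum:
  assumes "\<theta> \<in> base_polytope M" "X \<subseteq> ground M"
  shows "real (rank_of M (ground M)) - real (rank_of M (ground M - X)) \<le> sum \<theta> X"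
  using base_polytope_sum_ground[OF assms(1)] base_polytope_sum_le_rank[OF assms(1), of "ground M - X"]
    sum_diff[OF finite_ground assms(2), of \<theta>]
  by simp

section \<open>Minimizers of the energy\<close>

text \<open>
  The gradient of the energy at \<open>\<eta>\<close> is \<open>\<lambda>e. 2 * \<eta> e / \<sigma> e\<close>, and on the convex polytope its
  derivative at the minimizer towards any other point \<open>\<theta>\<close> is nonnegative.
\<close>

lemma energy_minimizer_linear:
  assumes pos: "\<forall>e \<in> ground M. \<sigma> e > 0"
    and \<eta>: "\<eta> \<in> base_polytope M" and min: "\<forall>\<theta> \<in> base_polytope M. energy \<sigma> M \<eta> \<le> energy \<sigma> M \<theta>"
    and \<theta>: "\<theta> \<in> base_polytope M"
  shows "(\<Sum>e\<in>ground M. inverse (\<sigma> e) * \<eta> e * \<eta> e) \<le> (\<Sum>e\<in>ground M. inverse (\<sigma> e) * \<eta> e * \<theta> e)"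
proof (rule ccontr)
  assume neg: "\<not> ?thesis"
  define D where "D = (\<Sum>e\<in>ground M. inverse (\<sigma> e) * \<eta> e * (\<theta> e - \<eta> e))"
  define Q where "Q = (\<Sum>e\<in>ground M. inverse (\<sigma> e) * (\<theta> e - \<eta> e)\<^sup>2)"
  have D: "D < 0" using neg by (simp add: D_def right_diff_distrib sum_subtractf)
  have Q: "0 \<le> Q" unfolding Q_def using pos by (intro sum_nonneg) (simp add: less_imp_le)
  have expand: "energy \<sigma> M ((1 - s) *\<^sub>R \<eta> + s *\<^sub>R \<theta>) = energy \<sigma> M \<eta> + s * (2 * D + s * Q)" for s
    unfolding energy_def D_def Q_def sum_distrib_left sum.distrib[symmetric] plus_fun_def scaleR_fun_def
    by (intro sum.cong refl) (simp add: power2_eq_square algebra_simps)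
  \<comment> \<open>A step so short that the quadratic term cannot make up for the linear decrease.\<close>
  define s where "s = min 1 (- D / (Q + 1))"
  have s: "0 < s" "s \<le> 1" using D Q by (auto simp: s_def divide_neg_pos)
  have "s * Q \<le> (- D / (Q + 1)) * Q" using Q by (intro mult_right_mono) (auto simp: s_def)
  also have "\<dots> \<le> - D" using D Q by (simp add: field_simps)
  finally have "s * (2 * D + s * Q) < 0" using s D by (intro mult_pos_neg) auto
  moreover have "convex (base_polytope M)" by (simp add: base_polytope_def)
  then have "(1 - s) *\<^sub>R \<eta> + s *\<^sub>R \<theta> \<in> base_polytope M" using \<eta> \<theta> s by (intro convexD) auto
  then have "energy \<sigma> M \<eta> \<le> energy \<sigma> M ((1 - s) *\<^sub>R \<eta> + s *\<^sub>R \<theta>)" using min by blast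
  ultimately show False using expand by simp
qed

text \<open>
  The minimizer of the energy favours elements of small \<open>\<eta> e / \<sigma> e\<close> as strongly as the polytope
  allows: if these values are smaller on \<open>F\<close> than off \<open>F\<close>, then every basis occurring in \<open>\<eta>\<close> meets
  \<open>F\<close> in as many elements as possible, since otherwise an exchange would give a basis of smaller
  weight.
\<close>

lemma sum_minimizer_eq_rank:
  assumes pos: "\<forall>e \<in> ground M. \<sigma> e > 0"
    and \<eta>: "\<eta> \<in> base_polytope M" and min: "\<forall>\<theta> \<in> base_polytope M. energy \<sigma> M \<eta> \<le> energy \<sigma> M \<theta>"
    and F: "F \<subseteq> ground M"
    and less: "\<And>e f. \<lbrakk>e \<in> ground M - F; f \<in> F\<rbrakk> \<Longrightarrow> inverse (\<sigma> f) * \<eta> f < inverse (\<sigma> e) * \<eta> e"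
  shows "sum \<eta> F = real (rank_of M F)"
proof -
  define w where "w = (\<lambda>e. inverse (\<sigma> e) * \<eta> e)"
  define m where "m = (\<Sum>e\<in>ground M. w e * \<eta> e)"
  obtain u where u: "\<And>B. B \<in> bases M \<Longrightarrow> 0 \<le> u B" "sum u (bases M) = 1"
    and u_sum: "\<And>w X. finite X \<Longrightarrow> (\<Sum>e\<in>X. w e * \<eta> e) = (\<Sum>B\<in>bases M. u B * sum w (B \<inter> X))"
    using base_polytope_decomposition[OF \<eta>] by metis
  have Bsub: "B \<subseteq> ground M" if "B \<in> bases M" for B using that bases_iff indep_ground by blast
  have min_weight: "m \<le> sum w B" if B: "B \<in> bases M" for B
  proof -
    have "indicator B \<in> base_polytope M"
      unfolding base_polytope_def using B by (intro hull_inc) auto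
    from energy_minimizer_linear[OF pos \<eta> min this]
    have "m \<le> (\<Sum>e\<in>ground M. w e * indicator B e)" by (simp add: m_def w_def)
    also have "\<dots> = sum w (ground M \<inter> B)"
      by (simp add: sum.inter_restrict finite_ground indicator_def if_distrib cong: if_cong)
    also have "ground M \<inter> B = B" using Bsub[OF B] by auto
    finally show ?thesis .
  qed
  \<comment> \<open>As \<open>m\<close> is the average of the weights with coefficients \<open>u\<close>, none of those that count exceeds it.\<close>
  have "m = (\<Sum>B\<in>bases M. u B * sum w B)"
    unfolding m_def u_sum[OF finite_ground] using Bsub by (intro sum.cong refl) (simp add: Int_absorb2)
  then have "(\<Sum>B\<in>bases M. u B * (sum w B - m)) = 0"
    using u(2) by (simp add: right_diff_distrib sum_subtractf flip: sum_distrib_right)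
  moreover have "0 \<le> u B * (sum w B - m)" if "B \<in> bases M" for B
    using u(1)[OF that] min_weight[OF that] by simp
  ultimately have supp: "u B = 0 \<or> sum w B = m" if "B \<in> bases M" for B
    using that finite_bases by (simp add: sum_nonneg_eq_0_iff)
  have tight: "card (B \<inter> F) = rank_of M F" if B: "B \<in> bases M" and wB: "sum w B = m" for B
  proof (rule ccontr)
    assume "card (B \<inter> F) \<noteq> rank_of M F"
    with card_basis_Int_le_rank[OF B, of F] have "card (B \<inter> F) < rank_of M F" by simp
    then obtain e f where ef: "e \<in> B - F" "f \<in> F - B" and B': "insert f (B - {e}) \<in> bases M"
      using basis_exchange_into[OF B] by blast
    have finB: "finite B" using Bsub[OF B] finite_ground finite_subset by blast
    have "sum w (insert f (B - {e})) = w f + sum w B - w e"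
      using ef finB by (simp add: sum_diff1)
    also have "\<dots> < m" using less[of e f] ef Bsub[OF B] wB by (auto simp: w_def)
    finally show False using min_weight[OF B'] by simp
  qed
  have "finite F" using F finite_ground finite_subset by blast
  from u_sum[OF this, of "\<lambda>_. 1"]
  have "sum \<eta> F = (\<Sum>B\<in>bases M. u B * real (card (B \<inter> F)))" by simp
  also have "\<dots> = (\<Sum>B\<in>bases M. u B * real (rank_of M F))"
    using supp tight by (intro sum.cong refl) fastforce
  finally show ?thesis using u(2) by (simp flip: sum_distrib_right)
qed

section \<open>Strength and contraction\<close>

lemma rank_drop_contract:
  assumes H: "H \<subseteq> ground M" and X: "X \<subseteq> ground M - H"
  shows "rank_of (contract M H) (ground (contract M H))
      = rank_of M (ground M) - rank_of M H"
    and "rank_of (contract M H) (ground (contract M H) - X)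
      = rank_of M (ground M - X) - rank_of M H"
    and "rank_of M H \<le> rank_of M (ground M - X)"
proof -
  have "H \<union> (ground M - H) = ground M" "H \<union> (ground M - H - X) = ground M - X"
    using H X by auto
  then show "rank_of (contract M H) (ground (contract M H))
      = rank_of M (ground M) - rank_of M H"
    and "rank_of (contract M H) (ground (contract M H) - X)
      = rank_of M (ground M - X) - rank_of M H"
    using rank_contract[OF H, of "ground M - H"] rank_contract[OF H, of "ground M - H - X"]
    by (auto simp: contract_def)
  show "rank_of M H \<le> rank_of M (ground M - X)" using H X by (intro rank_mono) auto
qed

lemma strength_contract:
  assumes H: "H \<subseteq> ground M"
  shows "strength \<sigma> (contract M H) =
     Min {sum \<sigma> X / (real (rank_of M (ground M)) - real (rank_of M (ground M - X))) | X.
          X \<subseteq> ground M - H \<and> rank_of M (ground M) > rank_of M (ground M - X)}"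
proof -
  let ?C = "contract M H"
  have g: "ground ?C = ground M - H" by (simp add: contract_def)
  have eq: "(rank_of ?C (ground M - H - X) < rank_of ?C (ground M - H)
        \<longleftrightarrow> rank_of M (ground M) > rank_of M (ground M - X))
      \<and> real (rank_of ?C (ground M - H)) - real (rank_of ?C (ground M - H - X))
        = real (rank_of M (ground M)) - real (rank_of M (ground M - X))"
    if "X \<subseteq> ground M - H" for X
    using rank_drop_contract[OF H that] rank_mono[of "ground M - X" "ground M"] by (auto simp: g)
  show ?thesis
    unfolding strength_def
    by (intro arg_cong[where f = Min] Collect_cong ex_cong1) (use eq in \<open>auto simp: g\<close>)
qed

text \<open>
  The lower bound \<open>1 / t\<close> holds for the ratio of every set \<open>X\<close>, and a set on which the density
  is \<open>t\<close> times the weight attains it if its complement is tight.  Restricting the minimum to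
  subsets of \<open>D\<close> serves \<open>M\<close> and its contractions at once.
\<close>

lemma Min_strength_ratio:
  assumes pos: "\<forall>e \<in> ground M. \<sigma> e > 0"
    and \<theta>: "\<theta> \<in> base_polytope M"
    and t: "0 < t" "\<forall>e \<in> ground M. \<theta> e \<le> t * \<sigma> e"
    and A: "A \<noteq> {}" "A \<subseteq> D" "D \<subseteq> ground M" "\<forall>e \<in> A. \<theta> e = t * \<sigma> e"
    and tight: "sum \<theta> (ground M - A) = real (rank_of M (ground M - A))"
  shows "rank_of M (ground M - A) < rank_of M (ground M)"
    and "Min {sum \<sigma> X / (real (rank_of M (ground M)) - real (rank_of M (ground M - X))) | X.
          X \<subseteq> D \<and> rank_of M (ground M) > rank_of M (ground M - X)} = 1 / t"
proof -
  have Ag: "A \<subseteq> ground M" using A by auto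
  have "sum \<theta> A = t * sum \<sigma> A" using A(4) by (simp add: sum_distrib_left)
  then have drop: "real (rank_of M (ground M)) - real (rank_of M (ground M - A)) = t * sum \<sigma> A"
    using base_polytope_sum_ground[OF \<theta>] tight sum_diff[OF finite_ground Ag, of \<theta>] by simp
  have \<sigma>A: "0 < sum \<sigma> A"
    using A(1) Ag pos finite_subset[OF Ag finite_ground] by (intro sum_pos) auto
  show less: "rank_of M (ground M - A) < rank_of M (ground M)"
    using drop mult_pos_pos[OF t(1) \<sigma>A] by linarith
  show "Min {sum \<sigma> X / (real (rank_of M (ground M)) - real (rank_of M (ground M - X))) | X.
          X \<subseteq> D \<and> rank_of M (ground M) > rank_of M (ground M - X)} = 1 / t"
    (is "Min {?q X | X. ?P X} = _")
  proof (rule Min_eqI)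
    have "{?q X | X. ?P X} \<subseteq> ?q ` Pow (ground M)" using A(3) by auto
    then show "finite {?q X | X. ?P X}" using finite_ground finite_subset by blast
    have "?q A = 1 / t" unfolding drop using t(1) \<sigma>A by (simp add: field_simps)
    then show "1 / t \<in> {?q X | X. ?P X}"
      using less A(2) by (auto intro!: exI[of _ A])
  next
    fix q assume "q \<in> {?q X | X. ?P X}"
    then obtain X where X: "q = ?q X" "X \<subseteq> D" "rank_of M (ground M) > rank_of M (ground M - X)"
      by blast
    have Xg: "X \<subseteq> ground M" using X A by auto
    have "sum \<theta> X \<le> t * sum \<sigma> X"
      unfolding sum_distrib_left using t(2) Xg by (intro sum_mono) auto
    then have "real (rank_of M (ground M)) - real (rank_of M (ground M - X)) \<le> t * sum \<sigma> X"
      using rank_drop_le_base_polytope_sum[OF \<theta> Xg] by linarith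
    then have "real (rank_of M (ground M)) - real (rank_of M (ground M - X)) \<le> sum \<sigma> X * t"
      by (simp add: mult.commute)
    then show "1 / t \<le> q" using X(1,3) t(1) by (simp add: divide_le_eq pos_le_divide_eq)
  qed
qed

end

theorem lemma6p4:
  fixes M :: "'a matroid_data" and \<sigma> \<eta> :: "'a \<Rightarrow> real" and E_max H :: "'a set"
  assumes "matroid M" and "loopless M" and "rank_of M (ground M) > 0"
    and "\<forall>e \<in> ground M. \<sigma> e > 0"
    and "\<eta> = universal_density \<sigma> M"
    and "E_max = {e \<in> ground M. \<forall>f \<in> ground M. inverse (\<sigma> f) * \<eta> f \<le> inverse (\<sigma> e) * \<eta> e}"
    and "H \<subseteq> ground M - E_max"
  shows "rank_of (contract M H) (ground (contract M H)) > 0 \<and>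
         strength \<sigma> (contract M H) = strength \<sigma> M"
proof -
  interpret matroid M by fact
  note pos = assms(4)
  define w where "w = (\<lambda>e. inverse (\<sigma> e) * \<eta> e)"
  have E_max: "E_max = {e \<in> ground M. \<forall>f \<in> ground M. w f \<le> w e}"
    using assms(6) by (simp add: w_def)
  have "\<eta> \<in> base_polytope M \<and> (\<forall>\<theta> \<in> base_polytope M. energy \<sigma> M \<eta> \<le> energy \<sigma> M \<theta>)"
    unfolding assms(5) universal_density_def by (rule theI'[OF universal_density_ex1[OF pos]])
  then have \<eta>: "\<eta> \<in> base_polytope M"
    and min: "\<forall>\<theta> \<in> base_polytope M. energy \<sigma> M \<eta> \<le> energy \<sigma> M \<theta>" by auto
  have total: "0 < sum \<eta> (ground M)" using base_polytope_sum_ground[OF \<eta>] assms(3) by simp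
  define t where "t = Max (w ` ground M)"
  have "ground M \<noteq> {}" using total by auto
  then have "t \<in> w ` ground M" unfolding t_def using finite_ground by (intro Max_in) auto
  then obtain e0 where e0: "e0 \<in> ground M" "w e0 = t" by auto
  have w_le: "w e \<le> t" if "e \<in> ground M" for e using that finite_ground by (simp add: t_def)
  have E_max_t: "E_max = {e \<in> ground M. w e = t}" unfolding E_max using e0 w_le by force
  have \<eta>_w: "\<eta> e = w e * \<sigma> e" if "e \<in> ground M" for e
    using bspec[OF pos that] by (simp add: w_def field_simps)
  have \<eta>_le: "\<forall>e \<in> ground M. \<eta> e \<le> t * \<sigma> e"
    using \<eta>_w w_le pos by (simp add: mult_right_mono less_imp_le)
  have t: "0 < t"
  proof (rule ccontr)
    assume "\<not> 0 < t"
    then have "\<eta> e \<le> 0" if "e \<in> ground M" for e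
      using \<eta>_le pos that mult_nonpos_nonneg[of t "\<sigma> e"] by force
    then show False using total sum_nonpos[of "ground M" \<eta>] by force
  qed
  have tight: "sum \<eta> (ground M - E_max) = real (rank_of M (ground M - E_max))"
  proof (rule sum_minimizer_eq_rank[OF pos \<eta> min])
    fix e f assume "e \<in> ground M - (ground M - E_max)" "f \<in> ground M - E_max"
    then show "inverse (\<sigma> f) * \<eta> f < inverse (\<sigma> e) * \<eta> e"
      using w_le[of f] by (auto simp: E_max_t w_def)
  qed auto
  have ne: "E_max \<noteq> {}" using e0 E_max_t by auto
  have on_max: "\<forall>e \<in> E_max. \<eta> e = t * \<sigma> e" using \<eta>_w by (auto simp: E_max_t)
  note ratio = Min_strength_ratio[OF pos \<eta> t \<eta>_le ne _ _ on_max tight]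
  have sub: "E_max \<subseteq> ground M" "E_max \<subseteq> ground M - H" and H: "H \<subseteq> ground M"
    using assms(7) E_max by auto
  have "rank_of M H \<le> rank_of M (ground M - E_max)" using assms(7) by (rule rank_mono)
  also have "\<dots> < rank_of M (ground M)" using ratio(1)[OF sub(1) subset_refl] by simp
  finally have "0 < rank_of (contract M H) (ground (contract M H))"
    using rank_drop_contract(1)[OF H, of "{}"] by simp
  moreover have "strength \<sigma> (contract M H) = 1 / t"
    unfolding strength_contract[OF H] using sub by (intro ratio(2)) auto
  moreover have "strength \<sigma> M = 1 / t"
    unfolding strength_def using sub by (intro ratio(2)) auto
  ultimately show ?thesis by simp
qed

end
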